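(* Consider the following directed graphs $G$, in each of which every node additionally carries a self-loop, and the marked edge $\alpha$: (a) cause and effect: nodes $H,Y$; edge $H\to Y$; $\alpha=(H\to Y)$. (b) chain: nodes $H,X,Y$; edges $H\to X$, $X\to Y$; $\alpha=(X\to Y)$. (e) instrumental variable: nodes $Z,H,X,Y$; edges $Z\to X$, $H\to X$, $H\to Y$, $X\to Y$; $\alpha=(X\to Y)$. (f) cycle with instrumental variable: nodes $Z,H,X,Y$; edges $Z\to X$, $H\to X$, $Y\to H$, $X\to Y$; $\alpha=(X\to Y)$. For $\Sigma\in\mathcal{M}^{p}_{G,\alpha}$, the sign of $\alpha$ (that is, of $A_\alpha$ for every $A\in\mathbb{R}^{d\times d}$ with $\operatorname{supp}(A)=E$ and $A\Sigma+\Sigma A^T=-D$ for some positive definite diagonal $D$) is expressed in terms of $\Sigma$ as follows: - for (a): $\operatorname{sign}(\alpha)=\operatorname{sign}(\sigma_{hy})$; - for (b): $\operatorname{sign}(\alpha)=\operatorname{sign}(\sigma_{hy})/\operatorname{sign}(\sigma_{hx})$; - for (e): $\operatorname{sign}(\alpha)=\operatorname{sign}(\sigma_{zy})/\operatorname{sign}(\sigma_{zx})$; - for (f): $$\operatorname{sign}(\alpha)=\begin{cases}\operatorname{sign}(\sigma_{zy}/\sigma_{zx}) & \text{if } \rho_{zy}\rho_{xy}/\rho_{zx}<1,\\ -\operatorname{sign}(\sigma_{zy}/\sigma_{zx}) & \text{if } \rho_{zy}\rho_{xy}/\rho_{zx}>1.\end{cases}$$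
   Context: Let $PD_d$ be the set of symmetric positive definite real $d\times d$ matrices and $PDD_d\subset PD_d$ the set of diagonal ones. $G=(V,E)$ is a finite directed graph with $V=\{V_1,\dots,V_d\}$; cycles and self-loops are allowed. $\operatorname{An}_G(V_i)$ is the set of all $V_k$ from which there is a directed path with at least one edge to $V_i$ (so $V_i\in \operatorname{An}_G(V_i)$ iff $V_i$ lies on a directed cycle, a self-loop counting as a cycle). For $A\in\mathbb{R}^{d\times d}$ the entry $A_{ij}$ corresponds to the edge $e=(V_j,V_i)$, i.e. $V_j\to V_i$, and we write $A_e:=A_{ij}$; $\operatorname{supp}(A)$ is the set of edges $(V_j,V_i)$ with $A_{ij}\neq 0$. The set of $t$-faithful covariance matrices is $$F_G:=\{\Sigma\in PD_d:\ \forall V_i,V_j\in V,\ \operatorname{An}_G(V_i)\cap\operatorname{An}_G(V_j)=\emptyset\iff\Sigma_{ij}=0\}.$$ For $k\in\{+,-\}$, $$\mathcal{M}^{k}_{G,e}:=\{\Sigma\in F_G:\exists A\in\mathbb{R}^{d\times d},\,D\in PDD_d \text{ with } A\Sigma+\Sigma A^T=-D,\ \operatorname{supp}(A)=E,\ \operatorname{sign}(A_e)=k\},$$ and $\mathcal{M}^{p}_{G,e}:=\mathcal{M}^{+}_{G,e}\cup\mathcal{M}^{-}_{G,e}$. Entries of $\Sigma$ are written $\sigma_{uv}$, with lower-case letters $h,x,y,z$ indicating the nodes $H,X,Y,Z$, and $\rho_{uv}:=\sigma_{uv}/\sqrt{\sigma_{uu}\sigma_{vv}}$ are the correlation coefficients.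 All variables are observed. *)

theory Defs
  imports "HOL-Analysis.Analysis"
begin

definition PD :: "(real ^ 'n ^ 'n) set" where
  "PD = {S. transpose S = S \<and> (\<forall>v. v \<noteq> 0 \<longrightarrow> v \<bullet> (S *v v) > 0)}"

definition PDD :: "(real ^ 'n ^ 'n) set" where
  "PDD = {D \<in> PD. \<forall>i j. i \<noteq> j \<longrightarrow> D $ i $ j = 0}"

text \<open>
  A directed graph has all elements of a finite type \<open>'n\<close> as its nodes and is given by its
  edge set; \<open>(j, i)\<close> is the edge from \<open>j\<close> to \<open>i\<close>. The matrix entry belonging to the edge
  \<open>(j, i)\<close> is \<open>A $ i $ j\<close>, with the indices swapped.
\<close>

definition An :: "('n \<times> 'n) set \<Rightarrow> 'n \<Rightarrow> 'n set" where
  "An E i = {k. (k, i) \<in> E\<^sup>+}"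

definition entry :: "real ^ 'n ^ 'n \<Rightarrow> 'n \<times> 'n \<Rightarrow> real" where
  "entry A e = A $ snd e $ fst e"

definition supp :: "real ^ 'n ^ 'n \<Rightarrow> ('n \<times> 'n) set" where
  "supp A = {e. entry A e \<noteq> 0}"

definition faithful :: "('n \<times> 'n) set \<Rightarrow> (real ^ 'n ^ 'n) set" where
  "faithful E = {S \<in> PD. \<forall>i j. An E i \<inter> An E j = {} \<longleftrightarrow> S $ i $ j = 0}"

definition drift :: "('n::finite \<times> 'n) set \<Rightarrow> real ^ 'n ^ 'n \<Rightarrow> (real ^ 'n ^ 'n) set" where
  "drift E S = {A. supp A = E \<and> (\<exists>D \<in> PDD. A ** S + S ** transpose A = - D)}"

text \<open>The sign \<open>k\<close> is \<open>1\<close> or \<open>-1\<close>.\<close>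

definition M_sign :: "real \<Rightarrow> ('n::finite \<times> 'n) set \<Rightarrow> 'n \<times> 'n \<Rightarrow> (real ^ 'n ^ 'n) set" where
  "M_sign k E e = {S \<in> faithful E. \<exists>A \<in> drift E S. sgn (entry A e) = k}"

definition M_p :: "('n::finite \<times> 'n) set \<Rightarrow> 'n \<times> 'n \<Rightarrow> (real ^ 'n ^ 'n) set" where
  "M_p E e = M_sign 1 E e \<union> M_sign (- 1) E e"

definition corr :: "real ^ 'n ^ 'n \<Rightarrow> 'n \<Rightarrow> 'n \<Rightarrow> real" where
  "corr S u v = S $ u $ v / sqrt (S $ u $ u * S $ v $ v)"

text \<open>
  The constructor names are reused, so they are qualified by their type below.
\<close>

datatype hy = H | Y
datatype hxy = H | X | Y
datatype zhxy = Z | H | X | Y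

instance hy :: finite
proof
  have "(UNIV :: hy set) = {hy.H, hy.Y}" by (auto intro: hy.exhaust)
  then show "finite (UNIV :: hy set)" by (metis finite.simps)
qed

instance hxy :: finite
proof
  have "(UNIV :: hxy set) = {hxy.H, hxy.X, hxy.Y}" by (auto intro: hxy.exhaust)
  then show "finite (UNIV :: hxy set)" by (metis finite.simps)
qed

instance zhxy :: finite
proof
  have "(UNIV :: zhxy set) = {zhxy.Z, zhxy.H, zhxy.X, zhxy.Y}" by (auto intro: zhxy.exhaust)
  then show "finite (UNIV :: zhxy set)" by (metis finite.simps)
qed

text \<open>\<open>Id\<close> contributes the self-loop at every node.\<close>

definition cause_effect :: "(hy \<times> hy) set" where
  "cause_effect = Id \<union> {(hy.H, hy.Y)}"

definition chain :: "(hxy \<times> hxy) set" where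
  "chain = Id \<union> {(hxy.H, hxy.X), (hxy.X, hxy.Y)}"

definition instrumental :: "(zhxy \<times> zhxy) set" where
  "instrumental = Id \<union>
     {(zhxy.Z, zhxy.X), (zhxy.H, zhxy.X), (zhxy.H, zhxy.Y), (zhxy.X, zhxy.Y)}"

definition cycle_instrumental :: "(zhxy \<times> zhxy) set" where
  "cycle_instrumental = Id \<union>
     {(zhxy.Z, zhxy.X), (zhxy.H, zhxy.X), (zhxy.Y, zhxy.H), (zhxy.X, zhxy.Y)}"

hide_const (open) hy.H hy.Y hxy.H hxy.X hxy.Y zhxy.Z zhxy.H zhxy.X zhxy.Y

end

theory Submission
  imports Defs
begin

text \<open>
  Everything comes from two kinds of entries of the Lyapunov equation
  \<open>A ** S + S ** transpose A = - D\<close>, where \<open>S\<close> is symmetric with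
  entries \<open>\<sigma>_{uv}\<close>.

  In each graph there is a source node \<open>i\<close> that serves as an instrument (\<open>H\<close> in the first two
  graphs, \<open>Z\<close> in the other two), and the marked edge \<open>x \<rightarrow> y\<close> is the only edge from another
  node into \<open>y\<close> that starts at a node correlated with \<open>i\<close>. In the instrumental-variable graph the
  edge \<open>H \<rightarrow> y\<close> drops out since \<open>Z\<close> and \<open>H\<close> have no common ancestor. Hence the
  \<open>(i, y)\<close> entry, which is zero on the right, reads
  \<open>A_{yx} \<sigma>_{ix} = - (A_{ii} + A_{yy}) \<sigma>_{iy}\<close>.
  This is lemma \<open>instrument_equation\<close>. A source has a negative diagonal entry, by the
  \<open>(i, i)\<close> entry of the equation (\<open>source_self_loop_negative\<close>).

  In the first three graphs \<open>y\<close> is a sink. Then \<open>A_{yy}\<close> is negative as well, which is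
  seen from the equation multiplied by the inverse of \<open>S\<close> on both sides
  (\<open>sink_self_loop_negative\<close>), and so \<open>A_{yx} \<sigma>_{ix}\<close> has the sign of \<open>\<sigma>_{iy}\<close>.

  In the cyclic graph \<open>A_{yy}\<close> may have either sign. There the \<open>(y, y)\<close> entry
  \<open>A_{yx} \<sigma>_{xy} + A_{yy} \<sigma>_{yy} < 0\<close> is used to eliminate \<open>A_{yy}\<close>. With \<open>A_{ii} < 0\<close> this leaves
  \<open>A_{yx} (c - 1) \<sigma>_{ix} / \<sigma>_{iy} < 0\<close> for the product of correlations
  \<open>c = \<rho>_{iy} \<rho>_{xy} / \<rho>_{ix}\<close>.
\<close>

section \<open>Entries of the Lyapunov equation\<close>

lemma drift_zero_entry:
  assumes "A \<in> drift E S" "(k, j) \<notin> E"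
  shows "A $ j $ k = 0"
  using assms by (auto simp: drift_def supp_def entry_def)

lemma PD_symmetric:
  assumes "S \<in> PD"
  shows "S $ i $ j = S $ j $ i"
proof -
  have "transpose S = S" using assms by (simp add: PD_def)
  then show ?thesis by (metis transpose_def vec_lambda_beta)
qed

lemma PD_diagonal_positive:
  assumes "S \<in> PD"
  shows "S $ i $ i > 0"
proof -
  have "axis i (1::real) \<noteq> 0" by (simp add: axis_eq_0_iff)
  then have "axis i 1 \<bullet> (S *v axis i 1) > 0" using assms by (auto simp: PD_def)
  then show ?thesis
    by (simp add: matrix_vector_mul_component inner_axis inner_axis')
qed

lemma lyapunov_entry:
  fixes A S :: "real ^ 'n ^ 'n"
  shows "(A ** S + S ** transpose A) $ i $ j
      = (\<Sum>k\<in>UNIV. A $ i $ k * S $ k $ j) + (\<Sum>k\<in>UNIV. A $ j $ k * S $ i $ k)"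
  by (simp add: matrix_matrix_mult_def transpose_def mult.commute)

lemma drift_off_diagonal:
  assumes "A \<in> drift E S" "i \<noteq> j"
  shows "(\<Sum>k\<in>UNIV. A $ i $ k * S $ k $ j) + (\<Sum>k\<in>UNIV. A $ j $ k * S $ i $ k) = 0"
proof -
  obtain D where "D \<in> PDD" and D: "A ** S + S ** transpose A = - D"
    using assms(1) by (auto simp: drift_def)
  then have "D $ i $ j = 0" using assms(2) by (simp add: PDD_def)
  then show ?thesis using lyapunov_entry[of A S i j] D by simp
qed

lemma drift_diagonal:
  assumes "A \<in> drift E S" "S \<in> PD"
  shows "(\<Sum>k\<in>UNIV. A $ i $ k * S $ k $ i) < 0"
proof -
  obtain D where "D \<in> PDD" and D: "A ** S + S ** transpose A = - D"
    using assms(1) by (auto simp: drift_def)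
  then have "D $ i $ i > 0" by (simp add: PDD_def PD_diagonal_positive)
  moreover have "S $ i $ k = S $ k $ i" for k using PD_symmetric[OF assms(2)] .
  ultimately show ?thesis using lyapunov_entry[of A S i i] D by simp
qed

section \<open>Self-loops at sources and sinks\<close>

lemma source_row_sum:
  fixes A S :: "real ^ 'n ^ 'n"
  assumes "A \<in> drift E S" "\<forall>k. (k, i) \<in> E \<longrightarrow> k = i"
  shows "(\<Sum>k\<in>UNIV. A $ i $ k * S $ k $ j) = A $ i $ i * S $ i $ j"
proof -
  have "(\<Sum>k\<in>UNIV. A $ i $ k * S $ k $ j) = (\<Sum>k\<in>{i}. A $ i $ k * S $ k $ j)"
    using assms drift_zero_entry[OF assms(1)] by (intro sum.mono_neutral_right) auto
  then show ?thesis by simp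
qed

lemma source_self_loop_negative:
  assumes "A \<in> drift E S" "S \<in> PD" "\<forall>k. (k, i) \<in> E \<longrightarrow> k = i"
  shows "A $ i $ i < 0"
  using drift_diagonal[OF assms(1,2), of i] source_row_sum[OF assms(1,3), of i]
    PD_diagonal_positive[OF assms(2), of i]
  by (simp add: mult_less_0_iff)

text \<open>
  Conjugating the equation with the inverse \<open>P\<close> of \<open>S\<close> gives
  \<open>P ** A + transpose A ** P = - (P ** D ** P)\<close>. If \<open>j\<close> is a sink, column \<open>j\<close> of \<open>A\<close> contains only the
  diagonal entry, so the \<open>(j, j)\<close> entry is \<open>2 P_{jj} A_{jj} < 0\<close>. The proof
  works with column \<open>j\<close> of \<open>P\<close>, the solution \<open>w\<close> of \<open>S *v w = axis j 1\<close>.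
\<close>
lemma sink_self_loop_negative:
  fixes A S :: "real ^ 'n ^ 'n"
  assumes A: "A \<in> drift E S" and S: "S \<in> PD" and sink: "\<forall>k. (j, k) \<in> E \<longrightarrow> k = j"
  shows "A $ j $ j < 0"
proof -
  obtain D where D: "D \<in> PDD" and lyap: "A ** S + S ** transpose A = - D"
    using A by (auto simp: drift_def)
  have sym: "transpose S = S" using S by (simp add: PD_def)
  have "\<forall>v. S *v v = 0 \<longrightarrow> v = 0"
    using S unfolding PD_def by (metis (mono_tags, lifting) inner_zero_right less_irrefl mem_Collect_eq)
  then have "invertible S"
    by (metis invertible_left_inverse matrix_left_invertible_ker)
  then obtain P where "S ** P = mat 1" by (auto simp: invertible_def)
  then have Sw: "S *v (P *v axis j 1) = axis j 1"
    by (simp add: matrix_vector_mul_assoc)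
  define w where "w = P *v axis j 1"
  have w: "S *v w = axis j 1" using Sw by (simp add: w_def)
  have "axis j (1::real) \<noteq> 0" by (simp add: axis_eq_0_iff)
  then have "w \<noteq> 0" using w by auto
  then have "w \<bullet> (S *v w) > 0" using S by (simp add: PD_def)
  then have wj: "w $ j > 0" by (simp add: w inner_axis)
  have "w \<bullet> (D *v w) > 0" using D \<open>w \<noteq> 0\<close> by (simp add: PDD_def PD_def)
  moreover have "(- D) *v w = - (D *v w)"
    using matrix_vector_mult_diff_rdistrib[of 0 D w] by simp
  ultimately have neg: "w \<bullet> ((A ** S + S ** transpose A) *v w) < 0"
    by (simp add: lyap)
  have Acol: "A *v axis j 1 = A $ j $ j *\<^sub>R axis j 1"
  proof -
    have "A $ k $ j = 0" if "k \<noteq> j" for k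
      using drift_zero_entry[OF A] sink that by blast
    then show ?thesis
      by (auto simp: vec_eq_iff matrix_vector_mul_component inner_axis) (auto simp: axis_def)
  qed
  have 1: "w \<bullet> ((A ** S) *v w) = A $ j $ j * w $ j"
    by (simp add: w Acol inner_axis flip: matrix_vector_mul_assoc)
  have "w \<bullet> ((S ** transpose A) *v w) = (S *v w) \<bullet> (transpose A *v w)"
    by (metis dot_lmul_matrix matrix_vector_mul_assoc sym transpose_matrix_vector)
  also have "\<dots> = (A *v axis j 1) \<bullet> w"
    by (metis w dot_lmul_matrix inner_commute transpose_matrix_vector)
  also have "\<dots> = A $ j $ j * w $ j" by (simp add: Acol inner_axis')
  finally have "2 * (A $ j $ j * w $ j) < 0"
    using neg 1 by (simp add: matrix_vector_mult_add_rdistrib inner_add_right)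
  then show ?thesis using wj by (simp add: mult_less_0_iff)
qed

section \<open>Instruments\<close>

text \<open>
  The node \<open>x\<close> is allowed to be the instrument \<open>i\<close> itself, so that a direct effect of a
  source is included.
\<close>
lemma instrument_equation:
  fixes A S :: "real ^ 'n ^ 'n"
  assumes A: "A \<in> drift E S" and source: "\<forall>k. (k, i) \<in> E \<longrightarrow> k = i"
    and "i \<noteq> y" "x \<noteq> y"
    and parents: "\<forall>k. (k, y) \<in> E \<longrightarrow> k = x \<or> k = y \<or> S $ i $ k = 0"
  shows "A $ y $ x * S $ i $ x = - (A $ i $ i + A $ y $ y) * S $ i $ y"
proof -
  have "(\<Sum>k\<in>UNIV. A $ y $ k * S $ i $ k) = (\<Sum>k\<in>{x, y}. A $ y $ k * S $ i $ k)"
    using parents drift_zero_entry[OF A] by (intro sum.mono_neutral_right) auto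
  then show ?thesis
    using drift_off_diagonal[OF A \<open>i \<noteq> y\<close>] source_row_sum[OF A source] \<open>x \<noteq> y\<close>
    by (simp add: algebra_simps)
qed

text \<open>
  The factor \<open>- (A_{ii} + A_{yy})\<close> in the instrument equation is positive, since both
  self-loops are negative.
\<close>
lemma sgn_instrument_sink:
  fixes A S :: "real ^ 'n ^ 'n"
  assumes A: "A \<in> drift E S" and S: "S \<in> PD" and source: "\<forall>k. (k, i) \<in> E \<longrightarrow> k = i"
    and sink: "\<forall>k. (y, k) \<in> E \<longrightarrow> k = y" and "i \<noteq> y" "x \<noteq> y"
    and parents: "\<forall>k. (k, y) \<in> E \<longrightarrow> k = x \<or> k = y \<or> S $ i $ k = 0"
    and corr: "S $ i $ x \<noteq> 0"
  shows "sgn (A $ y $ x) = sgn (S $ i $ y) / sgn (S $ i $ x)"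
proof -
  have "- (A $ i $ i + A $ y $ y) > 0"
    using source_self_loop_negative[OF A S source] sink_self_loop_negative[OF A S sink] by simp
  then have "sgn (- (A $ i $ i + A $ y $ y) * S $ i $ y) = sgn (S $ i $ y)"
    by (simp only: sgn_mult sgn_pos mult_1_left)
  then have "sgn (A $ y $ x * S $ i $ x) = sgn (S $ i $ y)"
    using instrument_equation[OF A source \<open>i \<noteq> y\<close> \<open>x \<noteq> y\<close> parents] by simp
  moreover have "sgn (S $ i $ x) \<noteq> 0" using corr by (simp add: sgn_zero_iff)
  ultimately show ?thesis unfolding sgn_mult by (metis nonzero_mult_div_cancel_right)
qed

text \<open>
  Here \<open>y\<close> may lie on a cycle. Multiplying \<open>A_{yx} \<sigma>_{xy} + A_{yy} \<sigma>_{yy} < 0\<close> by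
  \<open>\<sigma>_{iy}\<^sup>2\<close> and replacing \<open>A_{yy} \<sigma>_{iy}\<close> by means of
  \<open>instrument_equation\<close> gives
  \<open>A_{yx} \<sigma>_{iy} (\<sigma>_{xy} \<sigma>_{iy} - \<sigma>_{ix} \<sigma>_{yy}) < A_{ii} \<sigma>_{yy} \<sigma>_{iy}\<^sup>2 < 0\<close>.
\<close>
lemma instrument_inequality:
  fixes A S :: "real ^ 'n ^ 'n"
  assumes A: "A \<in> drift E S" and S: "S \<in> PD" and source: "\<forall>k. (k, i) \<in> E \<longrightarrow> k = i"
    and "i \<noteq> y" "x \<noteq> y"
    and parents: "\<forall>k. (k, y) \<in> E \<longrightarrow> k = x \<or> k = y"
    and corr: "S $ i $ y \<noteq> 0"
  shows "A $ y $ x * S $ i $ y * (S $ i $ y * S $ x $ y - S $ i $ x * S $ y $ y) < 0"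
proof -
  have eq: "A $ y $ x * S $ i $ x = - (A $ i $ i + A $ y $ y) * S $ i $ y"
    using parents by (intro instrument_equation[OF A source \<open>i \<noteq> y\<close> \<open>x \<noteq> y\<close>]) auto
  have "(\<Sum>k\<in>UNIV. A $ y $ k * S $ k $ y) = (\<Sum>k\<in>{x, y}. A $ y $ k * S $ k $ y)"
    using parents drift_zero_entry[OF A] by (intro sum.mono_neutral_right) auto
  then have neg: "A $ y $ x * S $ x $ y + A $ y $ y * S $ y $ y < 0"
    using drift_diagonal[OF A S, of y] \<open>x \<noteq> y\<close> by simp
  have sq: "(S $ i $ y)\<^sup>2 > 0" using corr by simp
  \<comment> \<open>regrouped so that the left-hand side of the instrument equation appears\<close>
  have "A $ y $ x * S $ i $ y * (S $ i $ y * S $ x $ y - S $ i $ x * S $ y $ y)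
      = (A $ y $ x * S $ x $ y) * (S $ i $ y)\<^sup>2 - (A $ y $ x * S $ i $ x) * (S $ i $ y * S $ y $ y)"
    by (simp add: algebra_simps power2_eq_square)
  also have "\<dots> = (A $ y $ x * S $ x $ y + A $ y $ y * S $ y $ y) * (S $ i $ y)\<^sup>2
      + A $ i $ i * (S $ y $ y * (S $ i $ y)\<^sup>2)"
    unfolding eq by (simp add: algebra_simps power2_eq_square)
  also have "\<dots> < 0"
    using neg sq source_self_loop_negative[OF A S source] PD_diagonal_positive[OF S, of y]
    by (simp only: add_neg_neg mult_neg_pos mult_pos_pos)
  finally show ?thesis .
qed

text \<open>
  The variances of \<open>i\<close> and \<open>x\<close> cancel. What remains compares the two products in
  \<open>instrument_inequality\<close>.
\<close>
lemma corr_ratio: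
  assumes "S \<in> PD"
  shows "corr S i y * corr S x y / corr S i x
    = S $ i $ y * S $ x $ y / (S $ i $ x * S $ y $ y)"
proof -
  have "S $ i $ i > 0" "S $ x $ x > 0" "S $ y $ y > 0"
    using PD_diagonal_positive[OF assms] by auto
  then show ?thesis by (simp add: corr_def real_sqrt_mult field_simps)
qed

section \<open>Common ancestors\<close>

lemma faithful_PD: "S \<in> faithful E \<Longrightarrow> S \<in> PD"
  by (simp add: faithful_def)

lemma faithful_nonzero:
  assumes "S \<in> faithful E" "(k, i) \<in> E\<^sup>+" "(k, j) \<in> E\<^sup>+"
  shows "S $ i $ j \<noteq> 0"
proof -
  have "An E i \<inter> An E j \<noteq> {}" using assms(2,3) by (auto simp: An_def)
  then show ?thesis using assms(1) by (auto simp: faithful_def)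
qed

lemma faithful_sources_zero:
  assumes "S \<in> faithful E" "i \<noteq> j"
    and "\<forall>k. (k, i) \<in> E \<longrightarrow> k = i" "\<forall>k. (k, j) \<in> E \<longrightarrow> k = j"
  shows "S $ i $ j = 0"
proof -
  have source: "An E l \<subseteq> {l}" if l: "\<forall>k. (k, l) \<in> E \<longrightarrow> k = l" for l
  proof -
    have "k = l" if "(k, l) \<in> E\<^sup>+" for k
      using that l by (induction rule: converse_trancl_induct) auto
    then show ?thesis by (auto simp: An_def)
  qed
  have "An E i \<inter> An E j = {}" using assms(2) source[OF assms(3)] source[OF assms(4)] by blast
  then show ?thesis using assms(1) by (auto simp: faithful_def)
qed

lemma M_p_faithful: "S \<in> M_p E e \<Longrightarrow> S \<in> faithful E"
  by (auto simp: M_p_def M_sign_def)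

section \<open>The four graphs\<close>

lemma sgn_cause_effect:
  assumes S: "S \<in> faithful cause_effect" and A: "A \<in> drift cause_effect S"
  shows "sgn (entry A (hy.H, hy.Y)) = sgn (S $ hy.H $ hy.Y)"
proof -
  note S' = faithful_PD[OF S]
  have "sgn (A $ hy.Y $ hy.H) = sgn (S $ hy.H $ hy.Y) / sgn (S $ hy.H $ hy.H)"
    using PD_diagonal_positive[OF S', of hy.H]
    by (intro sgn_instrument_sink[OF A S']) (auto simp: cause_effect_def)
  then show ?thesis using PD_diagonal_positive[OF S', of hy.H] by (simp add: entry_def)
qed

lemma sgn_chain:
  assumes S: "S \<in> faithful chain" and A: "A \<in> drift chain S"
  shows "sgn (entry A (hxy.X, hxy.Y)) = sgn (S $ hxy.H $ hxy.Y) / sgn (S $ hxy.H $ hxy.X)"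
proof -
  have "S $ hxy.H $ hxy.X \<noteq> 0"
    by (intro faithful_nonzero[OF S, of hxy.H] r_into_trancl) (auto simp: chain_def)
  then show ?thesis
    unfolding entry_def prod.sel
    by (intro sgn_instrument_sink[OF A faithful_PD[OF S]]) (auto simp: chain_def)
qed

lemma sgn_instrumental:
  assumes S: "S \<in> faithful instrumental" and A: "A \<in> drift instrumental S"
  shows "sgn (entry A (zhxy.X, zhxy.Y)) = sgn (S $ zhxy.Z $ zhxy.Y) / sgn (S $ zhxy.Z $ zhxy.X)"
proof -
  have "S $ zhxy.Z $ zhxy.X \<noteq> 0"
    by (intro faithful_nonzero[OF S, of zhxy.Z] r_into_trancl) (auto simp: instrumental_def)
  moreover have "S $ zhxy.Z $ zhxy.H = 0"
    by (intro faithful_sources_zero[OF S]) (auto simp: instrumental_def)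
  ultimately show ?thesis
    unfolding entry_def prod.sel
    by (intro sgn_instrument_sink[OF A faithful_PD[OF S]]) (auto simp: instrumental_def)
qed

text \<open>
  With \<open>\<sigma>_{zy} = r \<sigma>_{zx}\<close>, the instrument inequality says
  \<open>A_{yx} r (c - 1) < 0\<close> up to the positive factor \<open>\<sigma>_{zx}\<^sup>2 \<sigma>_{yy}\<close>. In
  particular it excludes \<open>c = 1\<close>.
\<close>
lemma sgn_cycle_instrumental:
  assumes S: "S \<in> faithful cycle_instrumental" and A: "A \<in> drift cycle_instrumental S"
  defines "c \<equiv> corr S zhxy.Z zhxy.Y * corr S zhxy.X zhxy.Y / corr S zhxy.Z zhxy.X"
    and "r \<equiv> S $ zhxy.Z $ zhxy.Y / S $ zhxy.Z $ zhxy.X"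
  shows "c < 1 \<and> sgn (entry A (zhxy.X, zhxy.Y)) = sgn r
    \<or> c > 1 \<and> sgn (entry A (zhxy.X, zhxy.Y)) = - sgn r"
proof -
  note S' = faithful_PD[OF S]
  let ?a = "A $ zhxy.Y $ zhxy.X" and ?zx = "S $ zhxy.Z $ zhxy.X" and ?zy = "S $ zhxy.Z $ zhxy.Y"
    and ?xy = "S $ zhxy.X $ zhxy.Y" and ?yy = "S $ zhxy.Y $ zhxy.Y"
  have Z_Z: "(zhxy.Z, zhxy.Z) \<in> cycle_instrumental\<^sup>+"
    and Z_X: "(zhxy.Z, zhxy.X) \<in> cycle_instrumental\<^sup>+"
    and X_Y: "(zhxy.X, zhxy.Y) \<in> cycle_instrumental\<^sup>+"
    by (auto simp: cycle_instrumental_def intro: r_into_trancl)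
  have zx: "?zx \<noteq> 0" using faithful_nonzero[OF S Z_Z Z_X] .
  have zy: "?zy \<noteq> 0" using faithful_nonzero[OF S Z_Z trancl_trans[OF Z_X X_Y]] .
  have yy: "?yy > 0" using PD_diagonal_positive[OF S'] .
  have "c = ?zy * ?xy / (?zx * ?yy)"
    unfolding c_def by (rule corr_ratio[OF S'])
  then have factor: "?zy * ?xy - ?zx * ?yy = ?zx * ?yy * (c - 1)"
    using zx yy by (simp add: field_simps)
  have "?a * ?zy * (?zy * ?xy - ?zx * ?yy) = (?a * r * (c - 1)) * (?zx\<^sup>2 * ?yy)"
    using zx unfolding factor by (simp add: r_def power2_eq_square)
  moreover have "?a * ?zy * (?zy * ?xy - ?zx * ?yy) < 0"
    using zy by (intro instrument_inequality[OF A S']) (auto simp: cycle_instrumental_def)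
  ultimately have "(?a * r * (c - 1)) * (?zx\<^sup>2 * ?yy) < 0" by metis
  moreover have "?zx\<^sup>2 * ?yy > 0" using zx yy by simp
  ultimately have "?a * r * (c - 1) < 0" by (metis mult_less_0_iff order.asym)
  then show ?thesis
    unfolding entry_def prod.sel by (auto simp: mult_less_0_iff zero_less_mult_iff)
qed

theorem lemma4p8:
  "(\<forall>S \<in> M_p cause_effect (hy.H, hy.Y). \<forall>A \<in> drift cause_effect S.
      sgn (entry A (hy.H, hy.Y)) = sgn (S $ hy.H $ hy.Y))
   \<and>
   (\<forall>S \<in> M_p chain (hxy.X, hxy.Y). \<forall>A \<in> drift chain S.
      sgn (entry A (hxy.X, hxy.Y)) = sgn (S $ hxy.H $ hxy.Y) / sgn (S $ hxy.H $ hxy.X))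
   \<and>
   (\<forall>S \<in> M_p instrumental (zhxy.X, zhxy.Y). \<forall>A \<in> drift instrumental S.
      sgn (entry A (zhxy.X, zhxy.Y)) = sgn (S $ zhxy.Z $ zhxy.Y) / sgn (S $ zhxy.Z $ zhxy.X))
   \<and>
   (\<forall>S \<in> M_p cycle_instrumental (zhxy.X, zhxy.Y). \<forall>A \<in> drift cycle_instrumental S.
      let c = corr S zhxy.Z zhxy.Y * corr S zhxy.X zhxy.Y / corr S zhxy.Z zhxy.X;
          r = S $ zhxy.Z $ zhxy.Y / S $ zhxy.Z $ zhxy.X
      in c < 1 \<and> sgn (entry A (zhxy.X, zhxy.Y)) = sgn r
       \<or> c > 1 \<and> sgn (entry A (zhxy.X, zhxy.Y)) = - sgn r)"
  unfolding Let_def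
  by (intro conjI ballI sgn_cause_effect sgn_chain sgn_instrumental sgn_cycle_instrumental)
    (simp_all only: M_p_faithful)

end
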